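(* Let $d\ge2$. For any finite set $Z=\{z_1,\dots,z_N\}\subset\mathbb S^d$ of $N$ points, $$\big\|\Delta_Z\big\|_2^2=\frac1{N^2}\sum_{i,j=1}^N\Big(\frac12-d(z_i,z_j)\Big)^2-\int_{\mathbb S^d}\int_{\mathbb S^d}\Big(\frac12-d(x,y)\Big)^2\,d\sigma(x)\,d\sigma(y).$$
   Context: $\mathbb S^d\subset\mathbb R^{d+1}$ is the unit sphere, $\sigma$ is its surface measure normalized so that $\sigma(\mathbb S^d)=1$, and $d(x,y)=\frac1\pi\arccos(x\cdot y)$ is the normalized geodesic distance. For $x,y\in\mathbb S^d$ let $W_{xy}=\{z\in\mathbb S^d:\ \mathrm{sgn}(x\cdot z)\ne\mathrm{sgn}(y\cdot z)\}$ (with $\mathrm{sgn}(0)=+1$; the choice does not affect the statement). Then $$\Delta_Z(x,y)=\frac1N\sum_{k=1}^N\mathbf 1_{W_{xy}}(z_k)-\sigma(W_{xy}),$$ where $\sigma(W_{xy})=d(x,y)$; equivalently, $\Delta_Z(x,y)$ is the proportion of the hyperplanes $z_k^\perp$ separating $x$ and $y$, minus $d(x,y)$. The norm is $\|\Delta_Z\|_2^2=\int_{\mathbb S^d}\int_{\mathbb S^d}\Delta_Z(x,y)^2\,d\sigma(x)\,d\sigma(y)$. *)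

theory Defs
  imports "HOL-Probability.Probability"
begin

text \<open>The normalized surface measure on the unit sphere, as a measure on the Borel subsets of
  the sphere: the image of the uniform distribution on the unit ball under the radial projection
  \<open>x \<mapsto> x / norm x\<close>.  This is the polar-coordinate definition of surface measure, where the measure
  of \<open>A\<close> is proportional to the volume of the cone over \<open>A\<close>
  (lemma \<open>emeasure_sphere_measure\<close> below).\<close>

definition sphere_measure :: "'a::euclidean_space measure" where
  "sphere_measure =
     restrict_space (distr (uniform_measure lborel (cball 0 1)) borel sgn) (sphere 0 1)"

lemma space_sphere_measure: "space sphere_measure = sphere 0 1"
  by (simp add: sphere_measure_def space_restrict_space)

lemma sets_sphere_measure: "sets sphere_measure = sets (restrict_space borel (sphere 0 1))"
  unfolding sphere_measure_def by (rule sets_restrict_space_cong) simp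

lemma emeasure_sphere_measure:
  fixes A :: "'a::euclidean_space set"
  assumes "A \<in> sets borel" "A \<subseteq> sphere 0 1"
  shows "emeasure sphere_measure A =
    emeasure lborel {r *\<^sub>R x | r x. 0 < r \<and> r \<le> 1 \<and> x \<in> A} / emeasure lborel (cball 0 1 :: 'a set)"
proof -
  have *: "sgn \<in> borel_measurable (uniform_measure lborel (cball 0 1 :: 'a set))"
    unfolding sgn_div_norm by measurable
  have "cball 0 1 \<inter> sgn -` A = {r *\<^sub>R x | r x. 0 < r \<and> r \<le> 1 \<and> x \<in> A}" (is "?L = ?R")
  proof (intro equalityI subsetI)
    fix y assume y: "y \<in> ?L"
    then have "y \<noteq> 0" using assms(2) by auto
    then have "y = norm y *\<^sub>R sgn y" by (simp add: sgn_div_norm)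
    with y \<open>y \<noteq> 0\<close> show "y \<in> ?R" by (auto intro!: exI[of _ "norm y"] exI[of _ "sgn y"])
  next
    fix y assume "y \<in> ?R"
    then obtain r x where "y = r *\<^sub>R x" "0 < r" "r \<le> 1" "x \<in> A" by auto
    moreover have "norm x = 1" using \<open>x \<in> A\<close> assms(2) by auto
    ultimately show "y \<in> ?L" by (simp add: sgn_div_norm)
  qed
  moreover have "sgn -` A \<in> sets (lborel :: 'a measure)"
    using measurable_sets[OF * assms(1)] by simp
  ultimately show ?thesis
    using assms * unfolding sphere_measure_def
    by (simp add: emeasure_restrict_space emeasure_distr)
qed

lemma prob_space_sphere_measure: "prob_space (sphere_measure :: 'a::euclidean_space measure)"
proof
  have "{r *\<^sub>R x | r (x::'a). 0 < r \<and> r \<le> 1 \<and> x \<in> sphere 0 1} = cball 0 1 - {0}" (is "?L = ?R")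
  proof (intro equalityI subsetI)
    fix y :: 'a assume y: "y \<in> ?R"
    then have "y = norm y *\<^sub>R sgn y" by (simp add: sgn_div_norm)
    with y show "y \<in> ?L"
      by (auto intro!: exI[of _ "norm y"] exI[of _ "sgn y"] simp: norm_sgn)
  qed auto
  moreover have "emeasure lborel (cball 0 1 - {0::'a}) = emeasure lborel (cball 0 (1::real) :: 'a set)"
    by (subst emeasure_Diff) auto
  moreover have "emeasure lborel (cball 0 1 :: 'a set) \<noteq> 0"
    using content_cball_pos[of 1 "0::'a"] by (auto simp: measure_def)
  moreover have "emeasure lborel (cball 0 1 :: 'a set) \<noteq> \<infinity>"
    using emeasure_lborel_cball_finite[of "0::'a" 1] by simp
  ultimately show "emeasure (sphere_measure :: 'a measure) (space sphere_measure) = 1"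
    by (simp add: space_sphere_measure emeasure_sphere_measure ennreal_divide_self top.not_eq_extremum)
qed

definition geodesic_dist :: "'a::real_inner \<Rightarrow> 'a \<Rightarrow> real" where
  "geodesic_dist x y = arccos (x \<bullet> y) / pi"

text \<open>The library function \<open>sgn\<close> has \<open>sgn 0 = 0\<close>; here the sign of 0 is \<open>+1\<close>.\<close>

definition sgn_pos :: "real \<Rightarrow> real" where
  "sgn_pos t = (if 0 \<le> t then 1 else - 1)"

definition wedge :: "'a::euclidean_space \<Rightarrow> 'a \<Rightarrow> 'a set" where
  "wedge x y = {z \<in> sphere 0 1. sgn_pos (x \<bullet> z) \<noteq> sgn_pos (y \<bullet> z)}"

definition Delta :: "'a::euclidean_space set \<Rightarrow> 'a \<Rightarrow> 'a \<Rightarrow> real" where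
  "Delta Z x y =
     1 / real (card Z) * (\<Sum>z\<in>Z. indicator (wedge x y) z) - measure sphere_measure (wedge x y)"

definition sphere_L2_norm :: "('a::euclidean_space \<Rightarrow> 'a \<Rightarrow> real) \<Rightarrow> real" where
  "sphere_L2_norm f = sqrt (LINT x|sphere_measure. LINT y|sphere_measure. (f x y)\<^sup>2)"

end

theory Submission
  imports Defs
begin

text \<open>
  The identity is a form of Stolarsky's invariance principle.  Write \<open>s x z = sgn_pos (x \<bullet> z)\<close>, a
  symmetric kernel with values \<open>1\<close> and \<open>- 1\<close>.  The indicator of \<open>wedge x y\<close> at \<open>z\<close> is
  \<open>(1 - s x z * s y z) / 2\<close>, so that \<open>Delta Z x y\<close> is \<open>- 1 / 2\<close> times the difference between the
  mean of \<open>s x z * s y z\<close> over \<open>z \<in> Z\<close> and its mean \<open>K x y\<close> over the whole sphere.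

  Squaring and integrating over \<open>x\<close> and \<open>y\<close>, Fubini's theorem turns each product of four signs into a
  product of two values of \<open>K\<close>, because \<open>s\<close> is symmetric.  The pairs of points of \<open>Z\<close> contribute the
  mean of \<open>(K z w)\<^sup>2\<close>.  The mixed terms contribute \<open>- 2\<close> times, and the remaining term contributes once,
  the mean of \<open>(K z w)\<^sup>2\<close> over \<open>w\<close>, which by symmetry of the sphere is the same constant for every \<open>z\<close>
  (\<open>integral_geodesic_dist_homogeneous\<close>).  This computation is \<open>kernel_discrepancy_L2\<close>.

  It remains to see that \<open>K z w = 1 - 2 * geodesic_dist z w\<close>, that is, that the wedge of two points has
  measure equal to their distance (\<open>measure_wedge\<close>).  Along a half great circle the measure of the wedge is
  additive and depends only on the length of the arc, so it is proportional to the length.  Both symmetry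
  arguments use reflections, and need that the surface measure is invariant under linear isometries.  By
  its definition from the volume of cones this follows from the same property of Lebesgue measure
  (\<open>distr_lborel_orthogonal_transformation\<close>).
\<close>

section \<open>Invariance of Lebesgue and surface measure under linear isometries\<close>

text \<open>The image \<open>\<nu>\<close> of Lebesgue measure under a linear isometry is again invariant under translations,
  and gives the unit ball \<open>B\<close> its Lebesgue measure.  Weil's argument for the uniqueness of Haar measure
  then identifies the two measures: by Fubini's theorem, translation invariance in each variable and
  \<open>B = - B\<close>, both \<open>\<nu> A * lborel B\<close> and \<open>lborel A * \<nu> B\<close> are the double integral of
  \<open>indicator A (x + y) * indicator B y\<close>.\<close>
lemma distr_lborel_orthogonal_transformation:
  fixes R :: "'a::euclidean_space \<Rightarrow> 'a"
  assumes R: "orthogonal_transformation R"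
  shows "distr lborel borel R = lborel"
proof -
  define B where "B = (cball 0 1 :: 'a set)"
  define \<nu> where "\<nu> = distr (lborel :: 'a measure) borel R"
  have lin: "linear R" and norm_R: "\<And>x. norm (R x) = norm x" and "bij R"
    using R by (auto simp: orthogonal_transformation orthogonal_transformation_bij)
  have [measurable]: "R \<in> borel_measurable borel"
    by (intro borel_measurable_continuous_onI linear_continuous_on linear_conv_bounded_linear[THEN iffD1] lin)
  have sets_\<nu> [measurable_cong]: "sets \<nu> = sets borel" by (simp add: \<nu>_def)
  have nn_\<nu>: "(\<integral>\<^sup>+ x. f x \<partial>\<nu>) = (\<integral>\<^sup>+ x. f (R x) \<partial>lborel)" if [measurable]: "f \<in> borel_measurable borel" for f :: "'a \<Rightarrow> ennreal"
    unfolding \<nu>_def by (subst nn_integral_distr) auto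
  have trans_lborel: "(\<integral>\<^sup>+ x. f (t + x) \<partial>lborel) = (\<integral>\<^sup>+ x. f x \<partial>lborel)"
    if [measurable]: "f \<in> borel_measurable borel" for f :: "'a \<Rightarrow> ennreal" and t
    by (subst (2) lborel_distr_plus[of t, symmetric], subst nn_integral_distr) auto
  have trans_\<nu>: "(\<integral>\<^sup>+ x. f (x + t) \<partial>\<nu>) = (\<integral>\<^sup>+ x. f x \<partial>\<nu>)"
    if [measurable]: "f \<in> borel_measurable borel" for f :: "'a \<Rightarrow> ennreal" and t
  proof -
    obtain u where u: "t = R u" using \<open>bij R\<close> by (metis bij_pointE)
    have "(\<integral>\<^sup>+ x. f (x + t) \<partial>\<nu>) = (\<integral>\<^sup>+ x. f (R (u + x)) \<partial>lborel)"
      by (subst nn_\<nu>) (auto simp: u linear_add[OF lin] add.commute)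
    also have "\<dots> = (\<integral>\<^sup>+ x. f (R x) \<partial>lborel)"
      by (rule trans_lborel) auto
    finally show ?thesis by (simp add: nn_\<nu>)
  qed
  have B [measurable]: "B \<in> sets borel" by (simp add: B_def)
  have B_pos: "emeasure lborel B \<noteq> 0"
    using content_cball_pos[of 1 "0::'a"] by (auto simp: B_def measure_def)
  have B_fin: "emeasure lborel B \<noteq> \<infinity>"
    using emeasure_lborel_cball_finite[of "0::'a" 1] by (simp add: B_def)
  have "emeasure \<nu> B = emeasure lborel (R -` B)"
    unfolding \<nu>_def by (subst emeasure_distr) auto
  also have "R -` B = B"
    by (auto simp: B_def norm_R)
  finally have \<nu>_B: "emeasure \<nu> B = emeasure lborel B" .
  have sf: "sigma_finite_measure \<nu>"
  proof
    have "emeasure \<nu> (cball 0 (real n)) \<noteq> \<infinity>" for n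
    proof -
      have "emeasure \<nu> (cball 0 (real n)) = emeasure lborel (R -` cball 0 (real n))"
        unfolding \<nu>_def by (subst emeasure_distr) auto
      also have "R -` cball 0 (real n) = cball 0 (real n)"
        by (auto simp: norm_R)
      finally show ?thesis
        using emeasure_lborel_cball_finite[of "0::'a" "real n"] by simp
    qed
    moreover have "(\<Union>n. cball 0 (real n)) = (UNIV :: 'a set)"
      using real_arch_simple by auto
    ultimately show "\<exists>A. countable A \<and> A \<subseteq> sets \<nu> \<and> \<Union> A = space \<nu> \<and> (\<forall>a\<in>A. emeasure \<nu> a \<noteq> \<infinity>)"
      by (intro exI[of _ "range (\<lambda>n. cball 0 (real n))"]) (auto simp: \<nu>_def)
  qed
  interpret P: pair_sigma_finite \<nu> "lborel :: 'a measure"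
    using sf by (simp add: pair_sigma_finite_def sigma_finite_lborel)
  have "emeasure \<nu> A = emeasure lborel A" if A [measurable]: "A \<in> sets borel" for A
  proof -
    have "emeasure \<nu> A * emeasure lborel B = (\<integral>\<^sup>+ y. (\<integral>\<^sup>+ x. indicator A x * indicator B y \<partial>\<nu>) \<partial>lborel)"
      by (simp add: nn_integral_multc nn_integral_cmult sets_\<nu>)
    also have "\<dots> = (\<integral>\<^sup>+ y. (\<integral>\<^sup>+ x. indicator A (x + y) * indicator B y \<partial>\<nu>) \<partial>lborel)"
      by (rule nn_integral_cong, rule trans_\<nu>[where f = "\<lambda>x. indicator A x * indicator B y" and t = y for y, symmetric])
        measurable
    also have "\<dots> = (\<integral>\<^sup>+ x. (\<integral>\<^sup>+ y. indicator A (x + y) * indicator B y \<partial>lborel) \<partial>\<nu>)"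
      by (rule P.Fubini') measurable
    also have "\<dots> = (\<integral>\<^sup>+ x. (\<integral>\<^sup>+ y. indicator A y * indicator B (y - x) \<partial>lborel) \<partial>\<nu>)"
      by (subst trans_lborel[where f = "\<lambda>y. indicator A y * indicator B (y - x)" and t = x for x, symmetric])
        auto
    also have "\<dots> = (\<integral>\<^sup>+ y. (\<integral>\<^sup>+ x. indicator A y * indicator B (y - x) \<partial>\<nu>) \<partial>lborel)"
      by (rule P.Fubini'[symmetric]) measurable
    also have "\<dots> = (\<integral>\<^sup>+ y. (\<integral>\<^sup>+ x. indicator A y * indicator B x \<partial>\<nu>) \<partial>lborel)"
      \<comment> \<open>Translate by \<open>y\<close>; the ball is symmetric about the origin.\<close>
    proof (rule nn_integral_cong)
      fix y
      have "(\<integral>\<^sup>+ x. indicator A y * indicator B (y - x) \<partial>\<nu>) = (\<integral>\<^sup>+ x. indicator A y * indicator B (y - (x + y)) \<partial>\<nu>)"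
        by (rule trans_\<nu>[symmetric]) measurable
      also have "\<dots> = (\<integral>\<^sup>+ x. indicator A y * indicator B x \<partial>\<nu>)"
        by (auto simp: B_def indicator_def intro!: nn_integral_cong)
      finally show "(\<integral>\<^sup>+ x. indicator A y * indicator B (y - x) \<partial>\<nu>) = (\<integral>\<^sup>+ x. indicator A y * indicator B x \<partial>\<nu>)" .
    qed
    also have "\<dots> = emeasure lborel A * emeasure lborel B"
      by (simp add: nn_integral_multc nn_integral_cmult sets_\<nu> \<nu>_B)
    finally show ?thesis
      using B_pos B_fin by (simp add: mult.commute[of _ "emeasure lborel B"] ennreal_mult_cancel_left)
  qed
  then show ?thesis
    unfolding \<nu>_def by (intro measure_eqI) auto
qed

text \<open>A linear isometry preserves the uniform distribution on the ball and commutes with the radial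
  projection \<open>sgn\<close>.\<close>
lemma distr_ball_direction_orthogonal_transformation:
  fixes R :: "'a::euclidean_space \<Rightarrow> 'a"
  assumes R: "orthogonal_transformation R"
  defines "D \<equiv> distr (uniform_measure lborel (cball 0 1)) borel sgn"
  shows "distr D borel R = D"
proof -
  let ?U = "uniform_measure lborel (cball 0 1 :: 'a set)"
  have lin: "linear R" and norm_R: "\<And>x. norm (R x) = norm x"
    using R by (auto simp: orthogonal_transformation)
  have [measurable]: "R \<in> borel_measurable borel"
    by (intro borel_measurable_continuous_onI linear_continuous_on linear_conv_bounded_linear[THEN iffD1] lin)
  have [measurable]: "(sgn :: 'a \<Rightarrow> 'a) \<in> borel_measurable borel"
    unfolding sgn_div_norm by measurable
  have U: "distr ?U borel R = ?U"
  proof (rule measure_eqI)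
    fix A :: "'a set" assume "A \<in> sets (distr ?U borel R)"
    then have A [measurable]: "A \<in> sets borel" by simp
    have "cball 0 1 \<inter> R -` A = R -` (cball 0 1 \<inter> A)"
      by (auto simp: norm_R)
    then have "emeasure lborel (cball 0 1 \<inter> R -` A) = emeasure (distr lborel borel R) (cball 0 1 \<inter> A)"
      by (subst emeasure_distr) auto
    then have "emeasure lborel (cball 0 1 \<inter> R -` A) = emeasure lborel (cball 0 1 \<inter> A)"
      by (simp add: distr_lborel_orthogonal_transformation[OF R])
    moreover have "R -` A \<in> sets borel"
      using measurable_sets[OF \<open>R \<in> borel_measurable borel\<close> A] by simp
    ultimately show "emeasure (distr ?U borel R) A = emeasure ?U A"
      by (subst emeasure_distr) auto
  qed simp
  have "distr D borel R = distr ?U borel (R \<circ> sgn)"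
    unfolding D_def by (rule distr_distr) auto
  also have "R \<circ> sgn = sgn \<circ> R"
    by (auto simp: sgn_div_norm norm_R linear_scale[OF lin])
  also have "distr ?U borel (sgn \<circ> R) = distr (distr ?U borel R) borel sgn"
    by (rule distr_distr[symmetric]) auto
  finally show ?thesis by (simp add: U D_def)
qed

lemma distr_sphere_measure_orthogonal_transformation:
  fixes R :: "'a::euclidean_space \<Rightarrow> 'a"
  assumes R: "orthogonal_transformation R"
  shows "R \<in> measurable sphere_measure sphere_measure"
    and "distr sphere_measure sphere_measure R = sphere_measure"
proof -
  let ?D = "distr (uniform_measure lborel (cball 0 1 :: 'a set)) borel sgn"
  have lin: "linear R" and norm_R: "\<And>x. norm (R x) = norm x"
    using R by (auto simp: orthogonal_transformation)
  have [measurable]: "R \<in> borel_measurable borel"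
    by (intro borel_measurable_continuous_onI linear_continuous_on linear_conv_bounded_linear[THEN iffD1] lin)
  have "R \<in> measurable (restrict_space borel (sphere 0 1)) (restrict_space borel (sphere 0 1))"
    by (rule measurable_restrict_space3) (auto simp: norm_R)
  then show meas: "R \<in> measurable sphere_measure sphere_measure"
    by (simp cong: measurable_cong_sets add: sets_sphere_measure)
  show "distr sphere_measure sphere_measure R = sphere_measure"
  proof (rule measure_eqI)
    fix A :: "'a set" assume "A \<in> sets (distr sphere_measure sphere_measure R)"
    then have A: "A \<in> sets borel" "A \<subseteq> sphere 0 1"
      by (auto simp: sets_sphere_measure sets_restrict_space)
    have RA: "R -` A \<in> sets borel" "R -` A \<subseteq> sphere 0 1"
      using A measurable_sets[OF \<open>R \<in> borel_measurable borel\<close> A(1)] by (auto simp: norm_R subset_iff)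
    have "emeasure (distr sphere_measure sphere_measure R) A = emeasure sphere_measure (R -` A)"
      using A RA meas by (subst emeasure_distr)
        (auto simp: sets_sphere_measure sets_restrict_space space_sphere_measure Int_absorb2)
    also have "\<dots> = emeasure ?D (R -` A)"
      unfolding sphere_measure_def using RA by (subst emeasure_restrict_space) auto
    also have "\<dots> = emeasure (distr ?D borel R) A"
      using A RA by (subst emeasure_distr) auto
    also have "\<dots> = emeasure sphere_measure A"
      unfolding distr_ball_direction_orthogonal_transformation[OF R] sphere_measure_def
      using A by (subst emeasure_restrict_space) auto
    finally show "emeasure (distr sphere_measure sphere_measure R) A = emeasure sphere_measure A" .
  qed simp
qed

text \<open>The cone over a great subsphere lies in a hyperplane, which is a Lebesgue null set.\<close>
lemma hyperplane_null_sphere_measure: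
  fixes x :: "'a::euclidean_space"
  assumes "x \<noteq> 0"
  shows "{v \<in> sphere 0 1. x \<bullet> v = 0} \<in> null_sets sphere_measure"
proof -
  let ?H = "{v \<in> sphere 0 1. x \<bullet> v = 0}"
  have eq: "?H = sphere 0 1 \<inter> {v. x \<bullet> v = 0}" by auto
  have H: "?H \<in> sets borel" unfolding eq by (intro sets.Int borel_closed closed_hyperplane) auto
  have "{r *\<^sub>R v | r v. 0 < r \<and> r \<le> 1 \<and> v \<in> ?H} \<subseteq> {v. x \<bullet> v = 0}"
    by auto
  moreover have "emeasure lborel {v. x \<bullet> v = 0} = 0"
    using negligible_hyperplane[of x 0] assms borel_closed[OF closed_hyperplane[of x 0]]
    by (auto simp: negligible_iff_null_sets null_sets_def)
  ultimately have "emeasure lborel {r *\<^sub>R v | r v. 0 < r \<and> r \<le> 1 \<and> v \<in> ?H} = 0"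
    using emeasure_mono[of _ "{v. x \<bullet> v = 0}" lborel] borel_closed[OF closed_hyperplane[of x 0]]
    by (metis (no_types, lifting) sets_lborel le_zero_eq)
  then have "emeasure sphere_measure ?H = 0"
    using H by (subst emeasure_sphere_measure) auto
  then show ?thesis
    using H by (auto simp: null_sets_def sets_sphere_measure sets_restrict_space)
qed

section \<open>Wedges and their measure\<close>

lemma measurable_sgn_pos [measurable]: "sgn_pos \<in> borel_measurable borel"
  unfolding sgn_pos_def by measurable

lemma wedge_in_sets [measurable]: "wedge x y \<in> sets sphere_measure"
proof -
  have "{z. sgn_pos (x \<bullet> z) \<noteq> sgn_pos (y \<bullet> z)} \<in> sets borel"
    by measurable
  moreover have "wedge x y = sphere 0 1 \<inter> {z. sgn_pos (x \<bullet> z) \<noteq> sgn_pos (y \<bullet> z)}"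
    by (auto simp: wedge_def)
  ultimately show ?thesis
    by (auto simp: sets_sphere_measure sets_restrict_space)
qed

lemma wedge_commute: "wedge x y = wedge y x"
  by (auto simp: wedge_def)

lemma wedge_self [simp]: "wedge x x = {}"
  by (auto simp: wedge_def)

lemma measure_wedge_orthogonal_transformation:
  fixes R :: "'a::euclidean_space \<Rightarrow> 'a"
  assumes R: "orthogonal_transformation R"
  shows "measure sphere_measure (wedge (R x) (R y)) = measure sphere_measure (wedge x y)"
proof -
  have "wedge x y = R -` wedge (R x) (R y) \<inter> space sphere_measure"
    using R by (auto simp: wedge_def space_sphere_measure orthogonal_transformation_def
        orthogonal_transformation_norm)
  then have "measure sphere_measure (wedge x y)
      = measure (distr sphere_measure sphere_measure R) (wedge (R x) (R y))"
    by (simp add: measure_distr distr_sphere_measure_orthogonal_transformation(1)[OF R] wedge_in_sets)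
  then show ?thesis
    by (simp add: distr_sphere_measure_orthogonal_transformation(2)[OF R])
qed

text \<open>Reversing \<open>x\<close> changes the side of \<open>x\<close> for every \<open>v\<close> off the great subsphere
  \<open>x \<bullet> v = 0\<close>, which is a null set.\<close>
lemma measure_wedge_minus:
  fixes x y :: "'a::euclidean_space"
  assumes "x \<noteq> 0"
  shows "measure sphere_measure (wedge (- x) y) = 1 - measure sphere_measure (wedge x y)"
proof -
  interpret prob_space "sphere_measure :: 'a measure" by (rule prob_space_sphere_measure)
  have "AE v in sphere_measure. v \<in> wedge (- x) y \<longleftrightarrow> v \<in> space sphere_measure - wedge x y"
    using AE_not_in[OF hyperplane_null_sphere_measure[OF assms]]
    by eventually_elim (auto simp: wedge_def space_sphere_measure sgn_pos_def split: if_splits)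
  then have "prob (wedge (- x) y) = prob (space sphere_measure - wedge x y)"
    by (intro finite_measure_eq_AE) auto
  also have "\<dots> = 1 - prob (wedge x y)"
    by (rule prob_compl) auto
  finally show ?thesis .
qed

text \<open>If \<open>y\<close> lies in the convex cone spanned by \<open>x\<close> and \<open>z\<close>, then a half-space containing both
  \<open>x\<close> and \<open>z\<close> contains \<open>y\<close>.  So a hyperplane separates \<open>x\<close> from \<open>z\<close> exactly if it separates \<open>y\<close>
  from one of them, and it cannot separate \<open>y\<close> from both.  The sign convention at \<open>0\<close> is compatible
  with this, so no null sets have to be discarded.\<close>
lemma measure_wedge_between:
  fixes x y z :: "'a::euclidean_space"
  assumes y: "k *\<^sub>R y = \<alpha> *\<^sub>R x + \<beta> *\<^sub>R z" and "k > 0" "\<alpha> \<ge> 0" "\<beta> \<ge> 0" "\<alpha> + \<beta> > 0"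
  shows "measure sphere_measure (wedge x z)
    = measure sphere_measure (wedge x y) + measure sphere_measure (wedge y z)"
proof -
  interpret prob_space "sphere_measure :: 'a measure" by (rule prob_space_sphere_measure)
  have yv: "k * (y \<bullet> v) = \<alpha> * (x \<bullet> v) + \<beta> * (z \<bullet> v)" for v
    using arg_cong[OF y, of "\<lambda>u. u \<bullet> v"] by (simp add: inner_add_left)
  have pos: "y \<bullet> v \<ge> 0" if "x \<bullet> v \<ge> 0" "z \<bullet> v \<ge> 0" for v
  proof -
    have "0 \<le> k * (y \<bullet> v)" unfolding yv using that assms by simp
    then show ?thesis using \<open>k > 0\<close> by (simp add: zero_le_mult_iff)
  qed
  have neg: "y \<bullet> v < 0" if "x \<bullet> v < 0" "z \<bullet> v < 0" for v
  proof -
    have "\<alpha> * (x \<bullet> v) \<le> 0" "\<beta> * (z \<bullet> v) \<le> 0"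
      using that assms by (auto simp: mult_le_0_iff)
    moreover have "\<alpha> * (x \<bullet> v) < 0 \<or> \<beta> * (z \<bullet> v) < 0"
      using that assms by (auto simp: mult_less_0_iff)
    ultimately have "k * (y \<bullet> v) < 0" unfolding yv by linarith
    then show ?thesis using \<open>k > 0\<close> by (simp add: mult_less_0_iff)
  qed
  have sp: "sgn_pos (y \<bullet> v) = sgn_pos (x \<bullet> v)" if "sgn_pos (x \<bullet> v) = sgn_pos (z \<bullet> v)" for v
    using that pos[of v] neg[of v] by (auto simp: sgn_pos_def not_le split: if_splits)
  have "(v \<in> wedge x z \<longleftrightarrow> v \<in> wedge x y \<or> v \<in> wedge y z) \<and> \<not> (v \<in> wedge x y \<and> v \<in> wedge y z)" for v
  proof (cases "sgn_pos (x \<bullet> v) = sgn_pos (z \<bullet> v)")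
    case True
    then show ?thesis using sp[OF True] by (simp add: wedge_def)
  next
    case False
    then show ?thesis by (simp add: wedge_def sgn_pos_def split: if_splits)
  qed
  then have "wedge x z = wedge x y \<union> wedge y z" "wedge x y \<inter> wedge y z = {}"
    by blast+
  then show ?thesis
    by (simp add: finite_measure_Union)
qed

text \<open>The mirror is the hyperplane orthogonal to \<open>u\<close>.  The vector \<open>u\<close> need not be normalized, and
  for \<open>u = 0\<close> division by zero makes this the identity.\<close>
definition reflection :: "'a::real_inner \<Rightarrow> 'a \<Rightarrow> 'a" where
  "reflection u v = v - (2 * (v \<bullet> u) / (u \<bullet> u)) *\<^sub>R u"

lemma orthogonal_transformation_reflection: "orthogonal_transformation (reflection u)"
proof -
  have "linear (reflection u)"
    by (rule linearI) (auto simp: reflection_def inner_add_left algebra_simps add_divide_distrib)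
  moreover have "reflection u v \<bullet> reflection u w = v \<bullet> w" for v w
    by (cases "u = 0") (auto simp: reflection_def inner_diff_left inner_diff_right inner_commute field_simps)
  ultimately show ?thesis
    by (simp add: orthogonal_transformation_def)
qed

lemma reflection_swap:
  assumes "norm z = norm w"
  shows "reflection (z - w) z = w"
proof (cases "z = w")
  case False
  have "z \<bullet> z = w \<bullet> w" using assms by (simp add: dot_square_norm)
  then have "2 * (z \<bullet> (z - w)) = (z - w) \<bullet> (z - w)"
    by (simp add: inner_diff_left inner_diff_right inner_commute)
  moreover have "(z - w) \<bullet> (z - w) \<noteq> 0" using False by simp
  ultimately show ?thesis by (simp add: reflection_def)
qed (simp add: reflection_def)

text \<open>Cauchy's functional equation: an additive function that is nonnegative is monotone, and comparing
  \<open>t\<close> with the two neighbouring multiples of \<open>L / Suc n\<close> leaves an error of at most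
  \<open>g L / Suc n\<close>.\<close>
lemma additive_nonneg_imp_linear_on_interval:
  fixes g :: "real \<Rightarrow> real"
  assumes add: "\<And>a b. 0 \<le> a \<Longrightarrow> 0 \<le> b \<Longrightarrow> a + b \<le> L \<Longrightarrow> g (a + b) = g a + g b"
    and nonneg: "\<And>a. g a \<ge> 0" and "L > 0" and t: "0 \<le> t" "t \<le> L"
  shows "g t = g L * t / L"
proof -
  have g0: "g 0 = 0" using add[of 0 0] \<open>L > 0\<close> by simp
  have mono: "g a \<le> g b" if "0 \<le> a" "a \<le> b" "b \<le> L" for a b
    using add[of a "b - a"] nonneg[of "b - a"] that by simp
  have mult: "g (real m * a) = real m * g a" if "0 \<le> a" "real m * a \<le> L" for m a
    using that
  proof (induction m)
    case (Suc m)
    then have "real m * a \<le> L" by (simp add: algebra_simps)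
    with Suc show ?case
      using add[of "real m * a" a] by (simp add: algebra_simps)
  qed (simp add: g0)
  have bound: "\<bar>g t - g L * t / L\<bar> \<le> g L * inverse (real (Suc n))" for n
  proof (cases "t = L")
    case False
    define h where "h = L / real (Suc n)"
    define m where "m = nat \<lfloor>t / h\<rfloor>"
    have "h > 0" using \<open>L > 0\<close> by (simp add: h_def)
    have L: "L = real (Suc n) * h" by (simp add: h_def)
    have gL: "g L = real (Suc n) * g h"
      using mult[of h "Suc n"] \<open>h > 0\<close> L by simp
    have q: "real m \<le> t / h" "t / h < real m + 1"
      using t \<open>h > 0\<close> by (auto simp: m_def)
    then have lo: "real m * h \<le> t" and hi: "t < real (Suc m) * h"
      using \<open>h > 0\<close> by (auto simp: field_simps)
    have "real m * h < real (Suc n) * h" using lo t False L by linarith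
    then have "m < Suc n" using \<open>h > 0\<close> by simp
    then have le: "real (Suc m) * h \<le> L" "real m * h \<le> L"
      unfolding L using \<open>h > 0\<close> by (auto intro!: mult_right_mono simp del: of_nat_Suc)
    have "real m * g h \<le> g t" "g t \<le> real (Suc m) * g h"
      using mono[of "real m * h" t] mono[of t "real (Suc m) * h"] lo hi le t \<open>h > 0\<close>
        mult[of h m] mult[of h "Suc m"] by (auto simp del: of_nat_Suc)
    moreover have eq: "g L * t / L = g h * (t / h)"
      unfolding gL using L \<open>h > 0\<close> by (simp add: field_simps del: of_nat_Suc)
    moreover have "g h * real m \<le> g h * (t / h)" "g h * (t / h) \<le> g h * (real m + 1)"
      using q nonneg[of h] by (auto intro: mult_left_mono simp del: times_divide_eq_right)
    ultimately have "\<bar>g t - g L * t / L\<bar> \<le> g h"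
      unfolding eq abs_le_iff by (simp add: algebra_simps)
    also have "g h = g L * inverse (real (Suc n))" by (simp add: gL)
    finally show ?thesis .
  qed (use \<open>L > 0\<close> nonneg in auto)
  have "(\<lambda>n. g L * inverse (real (Suc n))) \<longlonglongrightarrow> g L * 0"
    by (intro tendsto_intros LIMSEQ_inverse_real_of_nat)
  then have "\<bar>g t - g L * t / L\<bar> \<le> g L * 0"
    by (rule LIMSEQ_le_const) (use bound in auto)
  then show ?thesis by simp
qed

text \<open>Along the great circle \<open>c\<close> through \<open>x\<close> and \<open>f\<close>, the measure of the wedge of two points depends
  only on the distance of their parameters, since the reflections of the circle preserve it; it is additive
  by \<open>measure_wedge_between\<close>, and antipodal points have a wedge of measure one.  Hence it is
  proportional to the arc length.\<close>
lemma measure_wedge_arc: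
  fixes x f :: "'a::euclidean_space"
  assumes unit: "norm x = 1" "norm f = 1" and orth: "x \<bullet> f = 0" and t: "0 \<le> t" "t \<le> pi"
  shows "measure sphere_measure (wedge x (cos t *\<^sub>R x + sin t *\<^sub>R f)) = t / pi"
proof -
  interpret prob_space "sphere_measure :: 'a measure" by (rule prob_space_sphere_measure)
  define c where "c t = cos t *\<^sub>R x + sin t *\<^sub>R f" for t
  define w where "w a b = prob (wedge (c a) (c b))" for a b
  have xx: "x \<bullet> x = 1" "f \<bullet> f = 1" "f \<bullet> x = 0"
    using unit orth by (auto simp: dot_square_norm inner_commute)
  have w_commute: "w a b = w b a" for a b
    by (simp add: w_def wedge_commute)
  have w_reflect: "w (s - a) (s - b) = w a b" for s a b
  proof -
    \<comment> \<open>The mirror contains \<open>c (s/2)\<close>, so \<open>u\<close> is, up to sign, the tangent of the circle there.\<close>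
    define u where "u = sin (s/2) *\<^sub>R x - cos (s/2) *\<^sub>R f"
    have uu: "u \<bullet> u = 1"
      by (simp add: u_def inner_diff_left inner_diff_right xx orth flip: power2_eq_square)
    have "reflection u (c t) = c (s - t)" for t
    proof -
      have "c t \<bullet> u = sin (s/2 - t)"
        by (simp add: c_def u_def inner_diff_right inner_add_left xx orth sin_diff)
      then have "reflection u (c t) = c t - (2 * sin (s/2 - t)) *\<^sub>R u"
        by (simp add: reflection_def uu)
      also have "\<dots> = (cos t - 2 * sin (s/2 - t) * sin (s/2)) *\<^sub>R x
          + (sin t + 2 * sin (s/2 - t) * cos (s/2)) *\<^sub>R f"
        by (simp add: c_def u_def algebra_simps)
      also have "2 * sin (s/2 - t) * sin (s/2) = cos t - cos (s - t)"
        using sin_times_sin[of "s/2 - t" "s/2"] by (simp add: cos_minus[symmetric, of t] del: cos_minus) 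
      also have "2 * sin (s/2 - t) * cos (s/2) = sin (s - t) - sin t"
        using sin_times_cos[of "s/2 - t" "s/2"] by (simp add: algebra_simps)
      finally show ?thesis by (simp add: c_def)
    qed
    then show ?thesis
      using measure_wedge_orthogonal_transformation[OF orthogonal_transformation_reflection[of u]]
      by (metis w_def)
  qed
  define g where "g t = w 0 t" for t
  have c0: "c 0 = x" and cpi: "c pi = - x" by (auto simp: c_def)
  have x0: "x \<noteq> 0" using unit by auto
  have w_pi: "w a pi = 1 - g a" for a
    using measure_wedge_minus[OF x0, of "c a"] by (simp add: w_def g_def c0 cpi wedge_commute)
  have g_pi: "g pi = 1" using w_pi[of 0] by (simp add: g_def w_def)
  have g_add: "g (a + b) = g a + g b" if ab: "0 \<le> a" "0 \<le> b" "a + b \<le> pi" for a b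
  proof -
    consider "a + b = pi" | "a = 0" | "b = 0" | "0 < a" "0 < b" "a + b < pi" using ab by linarith
    then show ?thesis
    proof cases
      case 1
      \<comment> \<open>Here \<open>c (a + b) = - c 0\<close>, so \<open>c a\<close> need not lie in the cone of the end points.\<close>
      have "w a pi = w b 0" using w_reflect[of pi b 0] arg_cong[OF 1, of "\<lambda>r. r - b"] by simp
      then show ?thesis using w_pi[of a] g_pi 1 by (simp add: g_def w_commute[of b])
    next
      case 4
      have s: "sin (a + b) > 0" "sin a > 0" "sin b > 0" using 4 by (auto intro!: sin_gt_zero)
      have "sin (a + b) * cos a = sin b + sin a * cos (a + b)"
        using sin_diff[of "a + b" a] by (simp add: algebra_simps)
      then have "sin (a + b) *\<^sub>R c a = sin b *\<^sub>R c 0 + sin a *\<^sub>R c (a + b)"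
        by (simp add: c_def scaleR_add_right scaleR_add_left mult.commute)
      then have "w 0 (a + b) = w 0 a + w a (a + b)"
        unfolding w_def by (rule measure_wedge_between) (use s in auto)
      also have "w a (a + b) = w 0 b" using w_reflect[of "a + b" b 0] w_commute[of b 0] by simp
      finally show ?thesis by (simp add: g_def)
    qed (auto simp: g_def w_def)
  qed
  have "g t = g pi * t / pi"
    by (rule additive_nonneg_imp_linear_on_interval[OF g_add _ _ t]) (auto simp: g_def w_def)
  then show ?thesis by (simp add: g_pi) (simp add: g_def w_def c_def)
qed

text \<open>Points that are neither equal nor antipodal are joined by an arc as in \<open>measure_wedge_arc\<close>, with
  parameter \<open>arccos (x \<bullet> y)\<close>.\<close>
lemma measure_wedge:
  fixes x y :: "'a::euclidean_space"
  assumes x: "x \<in> sphere 0 1" and y: "y \<in> sphere 0 1"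
  shows "measure sphere_measure (wedge x y) = geodesic_dist x y"
proof -
  define k where "k = x \<bullet> y"
  have unit: "norm x = 1" "norm y = 1" and x0: "x \<noteq> 0" using x y by auto
  have xx: "x \<bullet> x = 1" "y \<bullet> y = 1" using unit by (auto simp: dot_square_norm)
  have k: "\<bar>k\<bar> \<le> 1" using Cauchy_Schwarz_ineq2[of x y] unit by (simp add: k_def)
  show ?thesis
  proof (cases "\<bar>k\<bar> = 1")
    case True
    have "(y - k *\<^sub>R x) \<bullet> (y - k *\<^sub>R x) = 1 - k\<^sup>2"
      by (simp add: inner_diff_left inner_diff_right xx k_def inner_commute power2_eq_square)
    moreover have "k\<^sup>2 = 1" using True by (simp add: power2_eq_1_iff abs_eq_iff')
    ultimately have "y = k *\<^sub>R x" by simp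
    with True consider "y = x" "k = 1" | "y = - x" "k = -1" by (auto simp: abs_if split: if_splits)
    then show ?thesis
    proof cases
      case 2
      then show ?thesis
        using measure_wedge_minus[OF x0, of x] by (simp add: geodesic_dist_def wedge_commute xx)
    qed (simp add: geodesic_dist_def xx)
  next
    case False
    define t where "t = arccos k"
    have t: "0 \<le> t" "t \<le> pi" and cos_t: "cos t = k" and sin_t: "sin t = sqrt (1 - k\<^sup>2)"
      using k by (auto simp: t_def arccos_lbound arccos_ubound cos_arccos_abs sin_arccos_abs)
    have "k\<^sup>2 < 1" using k False by (simp add: abs_square_less_1)
    then have "sin t \<noteq> 0" and sin2: "(sin t)\<^sup>2 = 1 - k\<^sup>2" by (auto simp: sin_t)
    \<comment> \<open>The Gram-Schmidt step that turns \<open>y\<close> into the unit tangent at \<open>x\<close> pointing to \<open>y\<close>.\<close>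
    define f where "f = (1 / sin t) *\<^sub>R (y - k *\<^sub>R x)"
    have "(y - k *\<^sub>R x) \<bullet> (y - k *\<^sub>R x) = (sin t)\<^sup>2"
      unfolding sin2 by (simp add: inner_diff_left inner_diff_right xx k_def inner_commute power2_eq_square)
    then have "f \<bullet> f = 1"
      using \<open>sin t \<noteq> 0\<close> by (simp add: f_def power2_eq_square)
    then have "norm f = 1" by (simp add: norm_eq_1)
    moreover have "x \<bullet> f = 0" by (simp add: f_def inner_diff_right xx k_def)
    moreover have "y = cos t *\<^sub>R x + sin t *\<^sub>R f" using \<open>sin t \<noteq> 0\<close> by (simp add: f_def cos_t)
    ultimately show ?thesis
      using measure_wedge_arc[of x f t] unit t by (simp add: geodesic_dist_def t_def k_def)
  qed
qed

section \<open>Square-mean discrepancy of a homogeneous kernel\<close>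

text \<open>The abstract form of the identity.  The square expands into \<open>a\<close> (pairs of points of \<open>Z\<close>), the mixed
  terms \<open>b\<close> and the term \<open>c\<close>.  Symmetry of the kernel \<open>s\<close> and Fubini's theorem give every term the same
  shape: integrating \<open>a z w\<close> yields \<open>(K z w)\<^sup>2\<close>, while each \<open>b z\<close> yields the integral of
  \<open>(K z w)\<^sup>2\<close> over \<open>w\<close>, as \<open>c\<close> does after averaging over \<open>z\<close>.  By homogeneity these are
  all equal to \<open>C\<close>, and \<open>- 2 * C + C = - C\<close> is the subtracted integral.  For \<open>Z = {}\<close> the
  mixed terms vanish, and the identity holds only if \<open>C = 0\<close>.\<close>
lemma kernel_discrepancy_L2:
  fixes s :: "'a \<Rightarrow> 'a \<Rightarrow> real" and M :: "'a measure"
  defines "K \<equiv> \<lambda>z w. LINT v|M. s z v * s w v"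
  assumes "prob_space M"
    and s_meas: "(\<lambda>p. s (fst p) (snd p)) \<in> borel_measurable (M \<Otimes>\<^sub>M M)"
    and s_bound: "\<And>x y. \<bar>s x y\<bar> \<le> 1" and s_sym: "\<And>x y. s x y = s y x"
    and Z: "finite Z" "Z \<noteq> {}" "Z \<subseteq> space M"
    and homogeneous: "\<And>z. z \<in> space M \<Longrightarrow> (LINT w|M. (K z w)\<^sup>2) = C"
  shows "(LINT x|M. LINT y|M. (1 / real (card Z) * (\<Sum>z\<in>Z. s x z * s y z) - K x y)\<^sup>2)
    = 1 / (real (card Z))\<^sup>2 * (\<Sum>z\<in>Z. \<Sum>w\<in>Z. (K z w)\<^sup>2) - (LINT x|M. LINT y|M. (K x y)\<^sup>2)"
proof -
  interpret prob_space M by fact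
  interpret P: pair_prob_space M M ..
  have s_measurable [measurable (raw)]: "(\<lambda>p. s (f p) (g p)) \<in> borel_measurable N"
    if [measurable]: "f \<in> measurable N M" "g \<in> measurable N M" for N :: "'b measure" and f g
    using measurable_compose[OF measurable_Pair s_meas, of f N g] by simp
  have K_measurable [measurable (raw)]: "(\<lambda>p. K (f p) (g p)) \<in> borel_measurable N"
    if [measurable]: "f \<in> measurable N M" "g \<in> measurable N M" for N :: "'b measure" and f g
    unfolding K_def by measurable
  have Zs [measurable]: "z \<in> space M" if "z \<in> Z" for z
    using that Z by auto
  have s_prod: "\<bar>s x y * s z w\<bar> \<le> 1" for x y z w
    using mult_mono[OF s_bound[of x y] s_bound[of z w]] by (simp add: abs_mult)
  have K_bound: "\<bar>K x y\<bar> \<le> 1" for x y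
  proof (cases "integrable M (\<lambda>v. s x v * s y v)")
    case True
    have "\<bar>K x y\<bar> \<le> (LINT v|M. \<bar>s x v * s y v\<bar>)"
      unfolding K_def by (rule integral_abs_bound)
    also have "\<dots> \<le> (LINT v|M. 1)"
      using True s_prod by (intro integral_mono) auto
    finally show ?thesis by (simp add: prob_space)
  qed (simp add: K_def not_integrable_integral_eq)
  have int_pair: "integrable (M \<Otimes>\<^sub>M M) f"
    if "f \<in> borel_measurable (M \<Otimes>\<^sub>M M)" "\<And>p. \<bar>f p\<bar> \<le> 1" for f :: "'a \<times> 'a \<Rightarrow> real"
    using that by (intro P.P.integrable_const_bound[where B = 1]) auto
  have iterated: "(LINT x|M. LINT y|M. f x y) = (LINT p|(M \<Otimes>\<^sub>M M). f (fst p) (snd p))"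
    if "integrable (M \<Otimes>\<^sub>M M) (\<lambda>p. f (fst p) (snd p))" for f :: "'a \<Rightarrow> 'a \<Rightarrow> real"
    using P.integral_fst'[OF that] by simp
  have swap: "(LINT x|M. LINT y|M. f x y) = (LINT y|M. LINT x|M. f x y)"
    if "(\<lambda>p. f (fst p) (snd p)) \<in> borel_measurable (M \<Otimes>\<^sub>M M)" "\<And>x y. \<bar>f x y\<bar> \<le> 1" for f :: "'a \<Rightarrow> 'a \<Rightarrow> real"
    using P.Fubini_integral[of f] int_pair[OF that(1)] that(2) by (simp add: case_prod_unfold)
  note bounds = abs_mult mult_le_one s_bound K_bound

  define a where "a z w p = (s (fst p) z * s (fst p) w) * (s (snd p) z * s (snd p) w)" for z w p
  define b where "b z p = s (fst p) z * s (snd p) z * K (fst p) (snd p)" for z p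
  define c where "c p = (K (fst p) (snd p))\<^sup>2" for p
  let ?N = "real (card Z)"
  have a_int: "integrable (M \<Otimes>\<^sub>M M) (a z w)" if "z \<in> Z" "w \<in> Z" for z w
    using Zs[OF that(1)] Zs[OF that(2)]
    unfolding a_def by (intro int_pair) (measurable, auto simp: bounds)
  have b_int: "integrable (M \<Otimes>\<^sub>M M) (b z)" if "z \<in> Z" for z
    using Zs[OF that]
    unfolding b_def by (intro int_pair) (measurable, auto simp: bounds)
  have c_int: "integrable (M \<Otimes>\<^sub>M M) c"
    unfolding c_def by (intro int_pair) (measurable, auto simp: abs_square_le_1 K_bound)
  have a_val: "(LINT p|(M \<Otimes>\<^sub>M M). a z w p) = (K z w)\<^sup>2" if "z \<in> Z" "w \<in> Z" for z w
  proof -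
    have "(LINT p|(M \<Otimes>\<^sub>M M). a z w p) = (LINT x|M. LINT y|M. (s x z * s x w) * (s y z * s y w))"
      using a_int[OF that] by (subst iterated) (auto simp: a_def[abs_def])
    also have "\<dots> = (K z w)\<^sup>2"
      by (simp add: K_def s_sym[of z] s_sym[of w] power2_eq_square)
    finally show ?thesis .
  qed
  have b_val: "(LINT p|(M \<Otimes>\<^sub>M M). b z p) = C" if "z \<in> Z" for z
  proof -
    note [measurable] = Zs[OF that]
    have "(LINT p|(M \<Otimes>\<^sub>M M). b z p) = (LINT x|M. LINT y|M. LINT v|M. s x z * s y z * (s x v * s y v))"
      using b_int[OF that] by (subst iterated) (auto simp: b_def[abs_def] K_def)
    \<comment> \<open>Write \<open>K x y\<close> as an integral over \<open>v\<close>, and carry out the integrations over \<open>y\<close> and \<open>x\<close> first.\<close>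
    also have "\<dots> = (LINT x|M. LINT v|M. LINT y|M. s x z * s y z * (s x v * s y v))"
      by (intro Bochner_Integration.integral_cong refl swap) (measurable, auto simp: bounds)
    also have "\<dots> = (LINT x|M. LINT v|M. s x z * s x v * K z v)"
    proof (intro Bochner_Integration.integral_cong refl)
      fix x v
      have "(LINT y|M. s x z * s y z * (s x v * s y v)) = (LINT y|M. (s x z * s x v) * (s z y * s v y))"
        by (simp add: s_sym[of z] s_sym[of v] mult_ac)
      then show "(LINT y|M. s x z * s y z * (s x v * s y v)) = s x z * s x v * K z v"
        by (simp add: K_def)
    qed
    also have "\<dots> = (LINT v|M. LINT x|M. s x z * s x v * K z v)"
      by (intro swap) (measurable, auto simp: bounds)
    also have "\<dots> = (LINT v|M. (K z v)\<^sup>2)"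
    proof (intro Bochner_Integration.integral_cong refl)
      fix v
      have "(LINT x|M. s x z * s x v * K z v) = (LINT x|M. s z x * s v x) * K z v"
        by (simp add: s_sym[of z] s_sym[of v])
      then show "(LINT x|M. s x z * s x v * K z v) = (K z v)\<^sup>2"
        by (simp add: K_def power2_eq_square)
    qed
    finally show ?thesis using homogeneous[of z] that Z by auto
  qed
  have c_val: "(LINT p|(M \<Otimes>\<^sub>M M). c p) = C" and c_val': "(LINT x|M. LINT y|M. (K x y)\<^sup>2) = C"
  proof -
    show "(LINT x|M. LINT y|M. (K x y)\<^sup>2) = C"
      using homogeneous by (simp add: prob_space cong: Bochner_Integration.integral_cong)
    then show "(LINT p|(M \<Otimes>\<^sub>M M). c p) = C"
      using c_int by (subst (asm) iterated) (auto simp: c_def[abs_def])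
  qed
  have expand: "(1 / ?N * (\<Sum>z\<in>Z. s (fst p) z * s (snd p) z) - K (fst p) (snd p))\<^sup>2
      = 1 / ?N\<^sup>2 * (\<Sum>z\<in>Z. \<Sum>w\<in>Z. a z w p) - 2 / ?N * (\<Sum>z\<in>Z. b z p) + c p" for p
  proof -
    have "(\<Sum>z\<in>Z. s (fst p) z * s (snd p) z)\<^sup>2 = (\<Sum>z\<in>Z. \<Sum>w\<in>Z. a z w p)"
      by (simp add: power2_eq_square sum_product a_def mult_ac)
    moreover have "(\<Sum>z\<in>Z. s (fst p) z * s (snd p) z) * K (fst p) (snd p) = (\<Sum>z\<in>Z. b z p)"
      by (simp add: sum_distrib_right b_def)
    ultimately show ?thesis
      by (simp add: power2_diff power_divide c_def algebra_simps)
  qed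
  have A_int: "integrable (M \<Otimes>\<^sub>M M) (\<lambda>p. \<Sum>z\<in>Z. \<Sum>w\<in>Z. a z w p)"
    and B_int: "integrable (M \<Otimes>\<^sub>M M) (\<lambda>p. \<Sum>z\<in>Z. b z p)"
    by (intro Bochner_Integration.integrable_sum a_int b_int; assumption)+
  have A_val: "(LINT p|(M \<Otimes>\<^sub>M M). (\<Sum>z\<in>Z. \<Sum>w\<in>Z. a z w p)) = (\<Sum>z\<in>Z. \<Sum>w\<in>Z. (K z w)\<^sup>2)"
    using a_int a_val by (simp add: Bochner_Integration.integral_sum Bochner_Integration.integrable_sum)
  have B_val: "(LINT p|(M \<Otimes>\<^sub>M M). (\<Sum>z\<in>Z. b z p)) = ?N * C"
    using b_int b_val by (simp add: Bochner_Integration.integral_sum)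
  have "(LINT x|M. LINT y|M. (1 / ?N * (\<Sum>z\<in>Z. s x z * s y z) - K x y)\<^sup>2)
      = (LINT p|(M \<Otimes>\<^sub>M M). 1 / ?N\<^sup>2 * (\<Sum>z\<in>Z. \<Sum>w\<in>Z. a z w p) - 2 / ?N * (\<Sum>z\<in>Z. b z p) + c p)"
    unfolding expand[symmetric]
    by (rule iterated, unfold expand)
      (intro Bochner_Integration.integrable_add Bochner_Integration.integrable_diff
        integrable_mult_right A_int B_int c_int)
  also have "\<dots> = 1 / ?N\<^sup>2 * (\<Sum>z\<in>Z. \<Sum>w\<in>Z. (K z w)\<^sup>2) - 2 / ?N * (?N * C) + C"
    using A_int B_int c_int
    by (simp add: Bochner_Integration.integral_add Bochner_Integration.integral_diff
        A_val B_val c_val del: integral_divide_zero)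
  also have "2 / ?N * (?N * C) = 2 * C"
    using Z by simp
  finally show ?thesis by (simp add: c_val')
qed

section \<open>The invariance principle on the sphere\<close>

lemma measurable_sphere_measure_borel:
  assumes "f \<in> measurable N (sphere_measure :: 'a::euclidean_space measure)"
  shows "f \<in> measurable N (borel :: 'a measure)"
proof -
  have "f \<in> measurable N (restrict_space borel (sphere 0 1))"
    using assms by (simp cong: measurable_cong_sets add: sets_sphere_measure)
  then show ?thesis by (simp add: measurable_restrict_space2_iff)
qed

text \<open>The product of the signs is \<open>- 1\<close> on the wedge and \<open>1\<close> off it.\<close>
lemma sgn_pos_correlation:
  fixes z w :: "'a::euclidean_space"
  assumes "z \<in> sphere 0 1" "w \<in> sphere 0 1"
  shows "(LINT v|sphere_measure. sgn_pos (z \<bullet> v) * sgn_pos (w \<bullet> v)) = 1 - 2 * geodesic_dist z w"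
proof -
  interpret prob_space "sphere_measure :: 'a measure" by (rule prob_space_sphere_measure)
  have "(LINT v|sphere_measure. sgn_pos (z \<bullet> v) * sgn_pos (w \<bullet> v))
      = (LINT v|sphere_measure. 1 - 2 * indicator (wedge z w) v)"
    by (rule Bochner_Integration.integral_cong)
      (auto simp: space_sphere_measure wedge_def sgn_pos_def indicator_def)
  also have "\<dots> = 1 - 2 * prob (wedge z w)"
    by (subst Bochner_Integration.integral_diff) (auto simp: prob_space integrable_real_indicator emeasure_eq_measure)
  finally show ?thesis by (simp add: measure_wedge[OF assms])
qed

text \<open>On the sphere the inner product stays within \<open>[-1, 1]\<close>, where \<open>arccos\<close> is continuous.\<close>
lemma measurable_geodesic_dist:
  fixes w :: "'a::euclidean_space"
  assumes "w \<in> sphere 0 1"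
  shows "geodesic_dist w \<in> borel_measurable sphere_measure"
proof -
  have "\<bar>w \<bullet> v\<bar> \<le> 1" if "v \<in> sphere 0 1" for v
    using Cauchy_Schwarz_ineq2[of w v] assms that by simp
  then have "continuous_on (sphere 0 1) (geodesic_dist w)"
    unfolding geodesic_dist_def by (intro continuous_intros) (auto simp: abs_le_iff)
  then have "geodesic_dist w \<in> borel_measurable (restrict_space borel (sphere 0 1))"
    by (rule borel_measurable_continuous_on_restrict)
  then show ?thesis by (simp cong: measurable_cong_sets add: sets_sphere_measure)
qed

text \<open>The reflection that exchanges \<open>z\<close> and \<open>w\<close> preserves both distance and measure.\<close>
lemma integral_geodesic_dist_homogeneous:
  fixes z w :: "'a::euclidean_space" and g :: "real \<Rightarrow> real"
  assumes zw: "z \<in> sphere 0 1" "w \<in> sphere 0 1" and g: "g \<in> borel_measurable borel"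
  shows "(LINT v|sphere_measure. g (geodesic_dist z v)) = (LINT v|sphere_measure. g (geodesic_dist w v))"
proof -
  define R where "R = reflection (z - w)"
  have R: "orthogonal_transformation R" and "R z = w"
    using zw by (auto simp: R_def orthogonal_transformation_reflection reflection_swap)
  then have "geodesic_dist w (R v) = geodesic_dist z v" for v
    unfolding geodesic_dist_def by (metis orthogonal_transformation_def)
  moreover have "(\<lambda>v. g (geodesic_dist w v)) \<in> borel_measurable sphere_measure"
    using measurable_compose[OF measurable_geodesic_dist[OF zw(2)] g] .
  ultimately show ?thesis
    using integral_distr[OF distr_sphere_measure_orthogonal_transformation(1)[OF R], of "\<lambda>v. g (geodesic_dist w v)"]
    by (simp add: distr_sphere_measure_orthogonal_transformation(2)[OF R])
qed

theorem theorem1p23: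
  fixes d N :: nat and Z :: "(real ^ 'n) set"
  assumes "CARD('n) = d + 1" and "d \<ge> 2"
    and "finite Z" and "card Z = N" and "N \<ge> 1" and "Z \<subseteq> sphere 0 1"
  shows "(sphere_L2_norm (Delta Z))\<^sup>2 =
    1 / (real N)\<^sup>2 * (\<Sum>z\<in>Z. \<Sum>w\<in>Z. (1 / 2 - geodesic_dist z w)\<^sup>2)
    - (LINT x|(sphere_measure :: (real ^ 'n) measure). LINT y|sphere_measure.
         (1 / 2 - geodesic_dist x y)\<^sup>2)"
proof -
  let ?S = "sphere 0 1 :: (real ^ 'n) set" and ?\<sigma> = "sphere_measure :: (real ^ 'n) measure"
  define s :: "real ^ 'n \<Rightarrow> real ^ 'n \<Rightarrow> real" where "s x z = sgn_pos (x \<bullet> z)" for x z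
  define K where "K z w = (LINT v|?\<sigma>. s z v * s w v)" for z w
  have K: "K z w = 2 * (1 / 2 - geodesic_dist z w)" if "z \<in> ?S" "w \<in> ?S" for z w
    using sgn_pos_correlation[OF that] by (simp add: K_def s_def)
  have K2: "(1 / 2 - geodesic_dist z w)\<^sup>2 = 1 / 4 * (K z w)\<^sup>2" if "z \<in> ?S" "w \<in> ?S" for z w
    by (simp add: K[OF that] power_mult_distrib del: right_diff_distrib_numeral)
  have "Z \<noteq> {}" using assms by auto
  have Delta: "(Delta Z x y)\<^sup>2 = 1 / 4 * (1 / real (card Z) * (\<Sum>z\<in>Z. s x z * s y z) - K x y)\<^sup>2"
    if xy: "x \<in> ?S" "y \<in> ?S" for x y
  proof -
    \<comment> \<open>The constant parts of the empirical mean and of the measure of the wedge cancel.\<close>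
    have "indicator (wedge x y) z = 1 / 2 - 1 / 2 * (s x z * s y z)" if "z \<in> Z" for z
      using that assms(6) by (auto simp: wedge_def s_def sgn_pos_def indicator_def)
    then have "(\<Sum>z\<in>Z. indicator (wedge x y) z) = (\<Sum>z\<in>Z. 1 / 2 - 1 / 2 * (s x z * s y z))"
      by (rule sum.cong[OF refl])
    also have "\<dots> = real (card Z) / 2 - 1 / 2 * (\<Sum>z\<in>Z. s x z * s y z)"
      by (simp add: sum_subtractf sum_distrib_left)
    finally have "Delta Z x y = - (1 / 2) * (1 / real (card Z) * (\<Sum>z\<in>Z. s x z * s y z) - K x y)"
      using assms \<open>Z \<noteq> {}\<close>
      by (simp add: Delta_def measure_wedge[OF xy] K[OF xy] right_diff_distrib)
    then show ?thesis by (simp add: power_mult_distrib power2_eq_square)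
  qed
  have s_meas: "(\<lambda>p. s (fst p) (snd p)) \<in> borel_measurable (?\<sigma> \<Otimes>\<^sub>M ?\<sigma>)"
    using measurable_sphere_measure_borel[OF measurable_fst] measurable_sphere_measure_borel[OF measurable_snd]
    unfolding s_def by measurable
  have g_meas: "(\<lambda>r :: real. (1 - 2 * r)\<^sup>2) \<in> borel_measurable borel"
    by measurable
  \<comment> \<open>Any unit vector can serve as the reference point.\<close>
  have homogeneous: "(LINT w|?\<sigma>. (K z w)\<^sup>2) = (LINT w|?\<sigma>. (K (axis undefined 1) w)\<^sup>2)"
    if "z \<in> space ?\<sigma>" for z
  proof -
    have e: "axis undefined 1 \<in> ?S" by simp
    have "(LINT w|?\<sigma>. (K u w)\<^sup>2) = (LINT w|?\<sigma>. (1 - 2 * geodesic_dist u w)\<^sup>2)" if "u \<in> ?S" for u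
      using that by (intro Bochner_Integration.integral_cong) (auto simp: K space_sphere_measure)
    then show ?thesis
      using integral_geodesic_dist_homogeneous[OF _ e g_meas, of z] e that
      by (simp add: space_sphere_measure)
  qed
  have "(sphere_L2_norm (Delta Z))\<^sup>2 = (LINT x|?\<sigma>. LINT y|?\<sigma>. (Delta Z x y)\<^sup>2)"
    by (simp add: sphere_L2_norm_def)
  also have "\<dots> = (LINT x|?\<sigma>. LINT y|?\<sigma>. 1 / 4 * (1 / real (card Z) * (\<Sum>z\<in>Z. s x z * s y z) - K x y)\<^sup>2)"
    by (intro Bochner_Integration.integral_cong refl Delta) (auto simp: space_sphere_measure)
  also have "\<dots> = 1 / 4 * (LINT x|?\<sigma>. LINT y|?\<sigma>. (1 / real (card Z) * (\<Sum>z\<in>Z. s x z * s y z) - K x y)\<^sup>2)"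
    by simp
  also have "\<dots> = 1 / 4 * (1 / (real (card Z))\<^sup>2 * (\<Sum>z\<in>Z. \<Sum>w\<in>Z. (K z w)\<^sup>2)
      - (LINT x|?\<sigma>. LINT y|?\<sigma>. (K x y)\<^sup>2))"
    unfolding K_def
    by (subst kernel_discrepancy_L2[OF prob_space_sphere_measure s_meas _ _ \<open>finite Z\<close> \<open>Z \<noteq> {}\<close> _
          homogeneous[unfolded K_def]])
      (use assms in \<open>auto simp: s_def sgn_pos_def inner_commute space_sphere_measure\<close>)
  also have "\<dots> = 1 / (real N)\<^sup>2 * (\<Sum>z\<in>Z. \<Sum>w\<in>Z. 1 / 4 * (K z w)\<^sup>2)
      - (LINT x|?\<sigma>. LINT y|?\<sigma>. 1 / 4 * (K x y)\<^sup>2)"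
    by (simp add: right_diff_distrib assms(4) sum_divide_distrib mult.commute[of _ 4])
  also have "(\<Sum>z\<in>Z. \<Sum>w\<in>Z. 1 / 4 * (K z w)\<^sup>2) = (\<Sum>z\<in>Z. \<Sum>w\<in>Z. (1 / 2 - geodesic_dist z w)\<^sup>2)"
    using assms(6) by (intro sum.cong refl K2[symmetric]) auto
  also have "(LINT x|?\<sigma>. LINT y|?\<sigma>. 1 / 4 * (K x y)\<^sup>2)
      = (LINT x|?\<sigma>. LINT y|?\<sigma>. (1 / 2 - geodesic_dist x y)\<^sup>2)"
    by (intro Bochner_Integration.integral_cong refl K2[symmetric]) (auto simp: space_sphere_measure)
  finally show ?thesis .
qed

end
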